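(* Let $\kappa$ be an uncountable regular cardinal. There is a closed subset $C$ of $\kappa^\kappa$ such that $C\notin\mathcal{D}_\kappa$ and there is no $\kappa$-Laver tree $T$ with $[T]\subseteq C$.
   Context: $\kappa^\kappa$ carries the bounded topology generated by the sets $[\sigma]=\{x\in\kappa^\kappa:\sigma\subseteq x\}$, $\sigma\in\kappa^{<\kappa}$. For $f:\kappa^{<\kappa}\to\kappa$ and $x\in\kappa^\kappa$, $x$ strongly dominates $f$ if there is $\alpha_0$ with $x(\alpha)\ge f(x\restriction\alpha)$ for all $\alpha>\alpha_0$. $X\subseteq\kappa^\kappa$ is a strongly dominating family if for every $f:\kappa^{<\kappa}\to\kappa$ some $x\in X$ strongly dominates $f$; $\mathcal{D}_\kappa$ is the ideal of sets which are not strongly dominating families. A tree is a subset of $\kappa^{<\kappa}$ closed under initial segments; $[T]=\{x\in\kappa^\kappa:\forall\alpha<\kappa\ (x\restriction\alpha\in T)\}$. $T$ is limit-closed if the union of any $\subseteq$-increasing sequence of elements of $T$ of limit length $<\kappa$ is in $T$. A $\kappa$-Laver tree is a limit-closed tree $T$ such that every $\sigma\in T$ extending $\mathrm{stem}(T)$ has $\kappa$ many immediate successors in $T$. *)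

theory Defs
  imports "HOL-Analysis.Analysis"
begin

unbundle cardinal_syntax

text \<open>
  A cardinal is a relation \<open>\<kappa>\<close> with \<open>Card_order \<kappa>\<close>. The ordinals below it are the elements of
  \<open>Field \<kappa>\<close>, and an ordinal \<open>\<alpha>\<close>, seen as the set of its predecessors, is \<open>underS \<kappa> \<alpha>\<close>. Sequences
  are partial maps, so that extension of sequences is \<open>\<subseteq>\<^sub>m\<close> and the restriction of \<open>x\<close> to
  \<open>\<alpha>\<close> is \<open>x |` underS \<kappa> \<alpha>\<close>.
\<close>

definition gen_baire :: "'a rel \<Rightarrow> ('a \<rightharpoonup> 'a) set" where
  "gen_baire \<kappa> = {x. dom x = Field \<kappa> \<and> ran x \<subseteq> Field \<kappa>}"

definition short_seqs :: "'a rel \<Rightarrow> ('a \<rightharpoonup> 'a) set" where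
  "short_seqs \<kappa> = {\<sigma>. (\<exists>\<alpha>\<in>Field \<kappa>. dom \<sigma> = underS \<kappa> \<alpha>) \<and> ran \<sigma> \<subseteq> Field \<kappa>}"

definition cone :: "'a rel \<Rightarrow> ('a \<rightharpoonup> 'a) \<Rightarrow> ('a \<rightharpoonup> 'a) set" where
  "cone \<kappa> \<sigma> = {x \<in> gen_baire \<kappa>. \<sigma> \<subseteq>\<^sub>m x}"

definition bounded_topology :: "'a rel \<Rightarrow> ('a \<rightharpoonup> 'a) topology" where
  "bounded_topology \<kappa> = topology_generated_by (cone \<kappa> ` short_seqs \<kappa>)"

definition strongly_dominates :: "'a rel \<Rightarrow> ('a \<rightharpoonup> 'a) \<Rightarrow> (('a \<rightharpoonup> 'a) \<Rightarrow> 'a) \<Rightarrow> bool" where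
  "strongly_dominates \<kappa> x f \<longleftrightarrow>
     (\<exists>\<alpha>\<^sub>0\<in>Field \<kappa>. \<forall>\<alpha>\<in>Field \<kappa>. (\<alpha>\<^sub>0, \<alpha>) \<in> \<kappa> \<and> \<alpha> \<noteq> \<alpha>\<^sub>0 \<longrightarrow>
        (f (x |` underS \<kappa> \<alpha>), the (x \<alpha>)) \<in> \<kappa>)"

definition strongly_dominating_family :: "'a rel \<Rightarrow> ('a \<rightharpoonup> 'a) set \<Rightarrow> bool" where
  "strongly_dominating_family \<kappa> X \<longleftrightarrow>
     (\<forall>f \<in> short_seqs \<kappa> \<rightarrow> Field \<kappa>. \<exists>x\<in>X. strongly_dominates \<kappa> x f)"

definition nondominating_ideal :: "'a rel \<Rightarrow> ('a \<rightharpoonup> 'a) set set" where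
  "nondominating_ideal \<kappa> = {X. X \<subseteq> gen_baire \<kappa> \<and> \<not> strongly_dominating_family \<kappa> X}"

definition is_tree :: "'a rel \<Rightarrow> ('a \<rightharpoonup> 'a) set \<Rightarrow> bool" where
  "is_tree \<kappa> T \<longleftrightarrow>
     T \<subseteq> short_seqs \<kappa> \<and> (\<forall>\<sigma>\<in>T. \<forall>\<tau>\<in>short_seqs \<kappa>. \<tau> \<subseteq>\<^sub>m \<sigma> \<longrightarrow> \<tau> \<in> T)"

definition branches :: "'a rel \<Rightarrow> ('a \<rightharpoonup> 'a) set \<Rightarrow> ('a \<rightharpoonup> 'a) set" where
  "branches \<kappa> T = {x \<in> gen_baire \<kappa>. \<forall>\<alpha>\<in>Field \<kappa>. x |` underS \<kappa> \<alpha> \<in> T}"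

definition is_limit :: "'a rel \<Rightarrow> 'a \<Rightarrow> bool" where
  "is_limit \<kappa> \<delta> \<longleftrightarrow> \<delta> \<in> Field \<kappa> \<and> underS \<kappa> \<delta> \<noteq> {} \<and>
     (\<forall>\<beta>\<in>underS \<kappa> \<delta>. \<exists>\<gamma>\<in>underS \<kappa> \<delta>. (\<beta>, \<gamma>) \<in> \<kappa> \<and> \<beta> \<noteq> \<gamma>)"

text \<open>
  The union of a chain of sequences is the unique partial map whose graph is the union of the graphs.
\<close>

definition limit_closed :: "'a rel \<Rightarrow> ('a \<rightharpoonup> 'a) set \<Rightarrow> bool" where
  "limit_closed \<kappa> T \<longleftrightarrow>
     (\<forall>\<delta> s u. is_limit \<kappa> \<delta> \<and> (\<forall>\<beta>\<in>underS \<kappa> \<delta>. s \<beta> \<in> T) \<and>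
        (\<forall>\<beta>\<in>underS \<kappa> \<delta>. \<forall>\<gamma>\<in>underS \<kappa> \<delta>. (\<beta>, \<gamma>) \<in> \<kappa> \<longrightarrow> s \<beta> \<subseteq>\<^sub>m s \<gamma>) \<and>
        Map.graph u = (\<Union>\<beta>\<in>underS \<kappa> \<delta>. Map.graph (s \<beta>))
        \<longrightarrow> u \<in> T)"

text \<open>The stem is the longest node that is comparable with every node of the tree.\<close>

definition comparable :: "('a \<rightharpoonup> 'b) \<Rightarrow> ('a \<rightharpoonup> 'b) \<Rightarrow> bool" where
  "comparable \<sigma> \<tau> \<longleftrightarrow> \<sigma> \<subseteq>\<^sub>m \<tau> \<or> \<tau> \<subseteq>\<^sub>m \<sigma>"

definition is_stem :: "('a \<rightharpoonup> 'a) set \<Rightarrow> ('a \<rightharpoonup> 'a) \<Rightarrow> bool" where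
  "is_stem T \<sigma> \<longleftrightarrow> \<sigma> \<in> T \<and> (\<forall>\<rho>\<in>T. comparable \<sigma> \<rho>) \<and>
     (\<forall>\<tau>\<in>T. (\<forall>\<rho>\<in>T. comparable \<tau> \<rho>) \<longrightarrow> \<tau> \<subseteq>\<^sub>m \<sigma>)"

definition immediate_successors ::
    "'a rel \<Rightarrow> ('a \<rightharpoonup> 'a) set \<Rightarrow> ('a \<rightharpoonup> 'a) \<Rightarrow> ('a \<rightharpoonup> 'a) set" where
  "immediate_successors \<kappa> T \<sigma> =
     {\<tau> \<in> T. \<exists>\<alpha>\<in>Field \<kappa>. \<exists>\<eta>\<in>Field \<kappa>. dom \<sigma> = underS \<kappa> \<alpha> \<and> \<tau> = \<sigma>(\<alpha> \<mapsto> \<eta>)}"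

text \<open>
  A Laver tree has a stem, and in particular is nonempty.
\<close>

definition laver_tree :: "'a rel \<Rightarrow> ('a \<rightharpoonup> 'a) set \<Rightarrow> bool" where
  "laver_tree \<kappa> T \<longleftrightarrow> is_tree \<kappa> T \<and> limit_closed \<kappa> T \<and>
     (\<exists>\<sigma>\<^sub>0. is_stem T \<sigma>\<^sub>0 \<and>
        (\<forall>\<sigma>\<in>T. \<sigma>\<^sub>0 \<subseteq>\<^sub>m \<sigma> \<longrightarrow> |immediate_successors \<kappa> T \<sigma>| =o \<kappa>))"

end

theory Submission
  imports Defs
begin

text \<open>
  Split the points of cofinality \<open>\<omega>\<close> below \<open>\<kappa>\<close> into two disjoint stationary sets \<open>S\<close> and \<open>S'\<close>,
  and let \<open>C\<close> consist of the \<open>x\<close> that are cofinal in a point of \<open>S\<close> on every block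
  \<open>[\<delta>, \<delta> + \<omega>)\<close>. A violation is visible in \<open>x \<restriction> (\<delta> + \<omega>)\<close>, so \<open>C\<close> is closed. Given \<open>f\<close>, each block can be
  filled with values dominating \<open>f\<close> and cofinal in a point of \<open>S\<close> that is closed under \<open>f\<close>, so \<open>C\<close>
  is strongly dominating. Given a Laver tree with stem of length \<open>\<delta>\<close>, a point of \<open>S'\<close> that is closed
  under choosing large successors is the supremum of the values on \<open>[\<delta>, \<delta> + \<omega>)\<close> of some branch,
  which thus lies outside \<open>C\<close>.
\<close>

section \<open>Order and cardinal arithmetic below a regular uncountable cardinal\<close>

locale uncountable_regular =
  fixes \<kappa> :: "'a rel"
  assumes card: "Card_order \<kappa>" and uncountable: "natLeq <o \<kappa>" and regular: "regularCard \<kappa>"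
begin

sublocale wo: wo_rel \<kappa>
  using card by unfold_locales (simp add: card_order_on_well_order_on)

abbreviation prec (infix "\<sqsubset>" 50) where "a \<sqsubset> b \<equiv> a \<in> underS \<kappa> b"
abbreviation preceq (infix "\<sqsubseteq>" 50) where "a \<sqsubseteq> b \<equiv> (a, b) \<in> \<kappa>"

abbreviation small :: "'b set \<Rightarrow> bool" where "small A \<equiv> |A| <o \<kappa>"

lemma Cinfinite: "Cinfinite \<kappa>"
  using card uncountable
  using cinfinite_mono[OF ordLess_imp_ordLeq natLeq_cinfinite] by blast

lemma prec_Field: "a \<sqsubset> b \<Longrightarrow> a \<in> Field \<kappa> \<and> b \<in> Field \<kappa>"
  by (auto simp: underS_def Field_def)

lemma preceq_refl: "a \<in> Field \<kappa> \<Longrightarrow> a \<sqsubseteq> a"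
  using wo.REFL by (rule refl_onD)

lemma preceq_trans: "a \<sqsubseteq> b \<Longrightarrow> b \<sqsubseteq> c \<Longrightarrow> a \<sqsubseteq> c"
  using wo.TRANS by (rule transD)

lemma preceq_antisym: "a \<sqsubseteq> b \<Longrightarrow> b \<sqsubseteq> a \<Longrightarrow> a = b"
  using wo.ANTISYM by (rule antisymD)

lemma prec_preceq_trans: "a \<sqsubset> b \<Longrightarrow> b \<sqsubseteq> c \<Longrightarrow> a \<sqsubset> c"
  unfolding underS_def using preceq_trans preceq_antisym by blast

lemma preceq_prec_trans: "a \<sqsubseteq> b \<Longrightarrow> b \<sqsubset> c \<Longrightarrow> a \<sqsubset> c"
  unfolding underS_def using preceq_trans preceq_antisym by blast

lemma prec_imp_preceq: "a \<sqsubset> b \<Longrightarrow> a \<sqsubseteq> b"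
  by (auto simp: underS_def)

lemma prec_trans: "a \<sqsubset> b \<Longrightarrow> b \<sqsubset> c \<Longrightarrow> a \<sqsubset> c"
  using prec_preceq_trans prec_imp_preceq by blast

lemma prec_irrefl: "\<not> a \<sqsubset> a"
  by (auto simp: underS_def)

lemma not_prec: "a \<in> Field \<kappa> \<Longrightarrow> b \<in> Field \<kappa> \<Longrightarrow> \<not> a \<sqsubset> b \<Longrightarrow> b \<sqsubseteq> a"
  unfolding underS_def using wo.TOTALS preceq_refl by blast

lemma prec_not_preceq: "a \<sqsubset> b \<Longrightarrow> \<not> b \<sqsubseteq> a"
  using prec_preceq_trans prec_irrefl by blast

lemma underS_inject:
  "underS \<kappa> a = underS \<kappa> b \<Longrightarrow> a \<in> Field \<kappa> \<Longrightarrow> b \<in> Field \<kappa> \<Longrightarrow> a = b"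
  by (metis wo.suc_underS)

lemma underS_mono: "a \<sqsubseteq> b \<Longrightarrow> underS \<kappa> a \<subseteq> underS \<kappa> b"
  by (auto intro: prec_preceq_trans)

lemma Field_nonempty: "Field \<kappa> \<noteq> {}"
  using Cinfinite by (auto simp: cinfinite_def)

lemma small_subset: "A \<subseteq> B \<Longrightarrow> small B \<Longrightarrow> small A"
  by (rule ordLeq_ordLess_trans[OF card_of_mono1])

lemma small_image: "small A \<Longrightarrow> small (f ` A)"
  by (rule ordLeq_ordLess_trans[OF card_of_image])

text \<open>Uncountability, beyond mere infinity, enters here: it makes countable unions of small
  sets small and puts suprema of omega-sequences below \<kappa>.\<close>

lemma small_countable: "countable A \<Longrightarrow> small A"
  using uncountable ordLeq_ordLess_trans[of "|A|" natLeq \<kappa>]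
  by (metis card_of_nat card_of_ordLeq countableE ordLeq_ordIso_trans subset_UNIV)

lemma small_UN: "small I \<Longrightarrow> (\<And>i. i \<in> I \<Longrightarrow> small (A i)) \<Longrightarrow> small (\<Union>i\<in>I. A i)"
  using card_of_UNION_ordLess_infinite_Field_regularCard[OF regular Cinfinite, of I A] by simp

lemma small_Un: "small A \<Longrightarrow> small B \<Longrightarrow> small (A \<union> B)"
  using small_UN[of "{True, False}" "\<lambda>b. if b then A else B"]
  by (simp add: small_countable Un_commute)

lemma small_underS: "a \<in> Field \<kappa> \<Longrightarrow> small (underS \<kappa> a)"
  by (rule card_of_underS[OF card])

text \<open>By induction on the length, then a countable union over all lengths. The closure
  conditions used later range over all finite blocks of values from an initial segment, and this
  bound keeps them small.\<close>

lemma small_lists: assumes "small A" shows "small (lists A)"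
proof -
  have "small {xs. set xs \<subseteq> A \<and> length xs = n}" for n
  proof (induction n)
    case 0
    have "{xs. set xs \<subseteq> A \<and> length xs = 0} = {[]}" by auto
    then show ?case by (simp add: small_countable)
  next
    case (Suc n)
    have "{xs. set xs \<subseteq> A \<and> length xs = Suc n}
        = (\<Union>a\<in>A. (#) a ` {xs. set xs \<subseteq> A \<and> length xs = n})"
      by (auto simp: length_Suc_conv)
    then show ?case by (simp only:) (intro small_UN assms small_image Suc)
  qed
  then have "small (\<Union>n. {xs. set xs \<subseteq> A \<and> length xs = n})"
    by (intro small_UN) (simp_all add: small_countable)
  moreover have "lists A = (\<Union>n. {xs. set xs \<subseteq> A \<and> length xs = n})"
    by (auto simp: lists_eq_set)
  ultimately show ?thesis by simp
qed

text \<open>By regularity a cofinal set has size \<kappa>, so a small one is bounded. The witness is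
  the least strict upper bound of \<open>K\<close>; the last property restates its
  minimality.\<close>

lemma small_strict_sup:
  assumes K: "K \<subseteq> Field \<kappa>" "small K"
  obtains g where "g \<in> Field \<kappa>" "K \<subseteq> underS \<kappa> g" "\<And>b. b \<sqsubset> g \<Longrightarrow> \<exists>k\<in>K. b \<sqsubseteq> k"
proof -
  have "\<not> |K| =o \<kappa>" by (rule not_ordLess_ordIso[OF K(2)])
  then have "\<not> cofinal K \<kappa>" using K(1) regular unfolding regularCard_def by metis
  then obtain a where a: "a \<in> Field \<kappa>" "\<forall>b\<in>K. \<not> (a \<noteq> b \<and> a \<sqsubseteq> b)"
    unfolding cofinal_def by meson
  have le: "b \<sqsubseteq> a" if "b \<in> K" for b
    by (rule not_prec) (use that K a in \<open>auto simp: underS_def\<close>)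
  \<comment> \<open>An infinite cardinal has no maximum, so the weak bound \<open>a\<close> can be
    exceeded and becomes a strict one.\<close>
  have "\<exists>b\<in>Field \<kappa>. a \<noteq> b \<and> (a, b) \<in> \<kappa>"
    using infinite_Card_order_limit[OF card _ a(1)] Cinfinite by (simp add: cinfinite_def)
  then obtain a' where a': "a \<sqsubset> a'" by (auto simp: underS_def)
  let ?U = "{g \<in> Field \<kappa>. K \<subseteq> underS \<kappa> g}"
  have "K \<subseteq> underS \<kappa> a'" using le preceq_prec_trans[OF _ a'] by auto
  then have "a' \<in> ?U" using prec_Field[OF a'] by simp
  then have g: "wo.minim ?U \<in> ?U" by (intro wo.minim_in) auto
  have "\<exists>k\<in>K. b \<sqsubseteq> k" if b: "b \<sqsubset> wo.minim ?U" for b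
  proof (rule ccontr)
    assume *: "\<not> ?thesis"
    have "k \<sqsubset> b" if "k \<in> K" for k
      using * that K(1) not_prec[of k b] prec_Field[OF b] by auto
    then have "b \<in> ?U" using prec_Field[OF b] by auto
    then have "wo.minim ?U \<sqsubseteq> b" by (intro wo.minim_least) auto
    then show False using prec_not_preceq[OF b] by simp
  qed
  then show ?thesis using that[of "wo.minim ?U"] g by simp
qed

section \<open>Ordinal successors\<close>

definition sc :: "'a \<Rightarrow> 'a" where "sc a = wo.minim {b. a \<sqsubset> b}"

lemma prec_sc: assumes "a \<in> Field \<kappa>" shows "a \<sqsubset> sc a"
proof -
  have "small {a}" by (simp add: small_countable)
  then obtain g where "a \<sqsubset> g" using small_strict_sup[of "{a}"] assms by auto
  moreover have "{b. a \<sqsubset> b} \<subseteq> Field \<kappa>" using prec_Field by auto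
  ultimately have "wo.minim {b. a \<sqsubset> b} \<in> {b. a \<sqsubset> b}"
    by (intro wo.minim_in) auto
  then show ?thesis by (simp add: sc_def)
qed

lemma sc_least: assumes "a \<sqsubset> b" shows "sc a \<sqsubseteq> b"
proof -
  have "{b. a \<sqsubset> b} \<subseteq> Field \<kappa>" using prec_Field by auto
  then show ?thesis unfolding sc_def by (rule wo.minim_least) (simp add: assms)
qed

lemma sc_Field: "a \<in> Field \<kappa> \<Longrightarrow> sc a \<in> Field \<kappa>"
  using prec_Field[OF prec_sc] by simp

lemma prec_sc_iff: assumes "a \<in> Field \<kappa>" shows "b \<sqsubset> sc a \<longleftrightarrow> b = a \<or> b \<sqsubset> a"
proof
  assume b: "b \<sqsubset> sc a"
  then have "\<not> a \<sqsubset> b" using sc_least prec_not_preceq[OF b] by auto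
  then have "b \<sqsubseteq> a" using not_prec assms prec_Field[OF b] by simp
  then show "b = a \<or> b \<sqsubset> a" by (auto simp: underS_def)
next
  assume "b = a \<or> b \<sqsubset> a"
  then show "b \<sqsubset> sc a" using prec_sc[OF assms] prec_trans[OF _ prec_sc[OF assms]] by auto
qed

lemma sc_inject: "a \<in> Field \<kappa> \<Longrightarrow> b \<in> Field \<kappa> \<Longrightarrow> sc a = sc b \<Longrightarrow> a = b"
  using prec_sc[of a] prec_sc[of b] prec_sc_iff[of a b] prec_sc_iff[of b a] prec_trans[of a b a]
    prec_irrefl[of a] by auto

lemma funpow_sc_Field: "a \<in> Field \<kappa> \<Longrightarrow> (sc ^^ n) a \<in> Field \<kappa>"
  by (induction n) (auto simp: sc_Field)


section \<open>Ladders and points of cofinality omega\<close>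

definition ladder :: "(nat \<Rightarrow> 'a) \<Rightarrow> 'a \<Rightarrow> bool" where
  "ladder e \<alpha> \<longleftrightarrow> (\<forall>n. e n \<sqsubset> e (Suc n)) \<and> (\<forall>n. e n \<sqsubset> \<alpha>) \<and> (\<forall>\<beta>\<in>underS \<kappa> \<alpha>. \<exists>n. \<beta> \<sqsubset> e n)"

definition cof_omega :: "'a set" where "cof_omega = {\<alpha>. \<exists>e. ladder e \<alpha>}"

lemma ladderD:
  assumes "ladder e \<alpha>"
  shows "e n \<sqsubset> e (Suc n)" "e n \<sqsubset> \<alpha>" "\<beta> \<sqsubset> \<alpha> \<Longrightarrow> \<exists>n. \<beta> \<sqsubset> e n"
  using assms unfolding ladder_def by auto

text \<open>The range of \<open>e\<close> is countable, hence small, and its least strict upper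
  bound is the required point. One further step along \<open>e\<close> turns the weak inequality of
  \<open>small_strict_sup\<close> into a strict one.\<close>

lemma increasing_ladder:
  assumes e: "\<And>n. e n \<sqsubset> e (Suc n)"
  shows "\<exists>\<alpha>. ladder e \<alpha>"
proof -
  have "range e \<subseteq> Field \<kappa>" using prec_Field[OF e] by auto
  moreover have "small (range e)" by (simp add: small_countable)
  ultimately obtain g where g: "range e \<subseteq> underS \<kappa> g" "\<And>b. b \<sqsubset> g \<Longrightarrow> \<exists>k\<in>range e. b \<sqsubseteq> k"
    using small_strict_sup by metis
  have "\<exists>n. b \<sqsubset> e n" if b: "b \<sqsubset> g" for b
  proof -
    obtain n where "b \<sqsubseteq> e n" using g(2)[OF b] by auto
    then show ?thesis using preceq_prec_trans[OF _ e] by auto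
  qed
  then have "ladder e g" unfolding ladder_def using e g(1) by auto
  then show ?thesis ..
qed

text \<open>A point with a ladder is a limit. This lets finitely many parameters below it be handled
  by a single index of a closure condition.\<close>

lemma ladder_finite_bound:
  assumes e: "ladder e \<alpha>" and "finite F" "F \<subseteq> underS \<kappa> \<alpha>"
  shows "\<exists>\<beta>. \<beta> \<sqsubset> \<alpha> \<and> F \<subseteq> underS \<kappa> \<beta>"
  using assms(2,3)
proof (induction F rule: finite_induct)
  case empty
  then show ?case using ladderD(2)[OF e] by auto
next
  case (insert x F)
  then obtain \<beta> where b: "\<beta> \<sqsubset> \<alpha>" "F \<subseteq> underS \<kappa> \<beta>" by auto
  obtain n where n: "x \<sqsubset> e n" using insert.prems ladderD(3)[OF e, of x] by auto
  show ?case
  proof (cases "e n \<sqsubset> \<beta>")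
    case True
    then show ?thesis using b prec_trans[OF n] by (intro exI[of _ \<beta>]) auto
  next
    case False
    then have "\<beta> \<sqsubseteq> e n" using not_prec prec_Field[OF b(1)] prec_Field[OF n] by simp
    from underS_mono[OF this] show ?thesis
      using b(2) n ladderD(2)[OF e] by (intro exI[of _ "e n"]) auto
  qed
qed

section \<open>Closure points and stationary sets\<close>

text \<open>Set-valued functions are used so that one \<open>R\<close> can collect the values of
  many functions over a whole initial segment, making closure under all of them a single
  condition.\<close>

definition small_family :: "('a \<Rightarrow> 'a set) \<Rightarrow> bool" where
  "small_family R \<longleftrightarrow> (\<forall>\<beta>\<in>Field \<kappa>. R \<beta> \<subseteq> Field \<kappa> \<and> small (R \<beta>))"

definition closure_point :: "('a \<Rightarrow> 'a set) \<Rightarrow> 'a \<Rightarrow> bool" where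
  "closure_point R \<alpha> \<longleftrightarrow> (\<forall>\<beta>\<in>underS \<kappa> \<alpha>. R \<beta> \<subseteq> underS \<kappa> \<alpha>)"

text \<open>The sets of closure points of small families generate the club filter, so for subsets of
  \<open>cof_omega\<close> this is stationarity.\<close>

definition stationary :: "'a set \<Rightarrow> bool" where
  "stationary S \<longleftrightarrow> (\<forall>R. small_family R \<longrightarrow> (\<exists>\<alpha>\<in>S. closure_point R \<alpha>))"

text \<open>Iterate omega times a map \<open>c\<close> that jumps above all values of
  \<open>R\<close> on the previous initial segment. It exists by regularity, and the supremum of the
  iterates is closed under \<open>R\<close>.\<close>

lemma closure_points_unbounded:
  assumes R: "small_family R" and b0: "\<beta>\<^sub>0 \<in> Field \<kappa>"
  shows "\<exists>\<alpha>. \<alpha> \<in> cof_omega \<and> \<beta>\<^sub>0 \<sqsubset> \<alpha> \<and> closure_point R \<alpha>"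
proof -
  have "\<exists>c. b \<sqsubset> c \<and> (\<forall>\<beta>\<in>underS \<kappa> b. R \<beta> \<subseteq> underS \<kappa> c)" if "b \<in> Field \<kappa>" for b
  proof -
    let ?K = "{b} \<union> (\<Union>\<beta>\<in>underS \<kappa> b. R \<beta>)"
    have "small ?K"
      using R prec_Field unfolding small_family_def
      by (intro small_Un small_UN small_underS that) (auto simp: small_countable)
    moreover have "?K \<subseteq> Field \<kappa>" using R that prec_Field unfolding small_family_def by blast
    ultimately obtain c where "?K \<subseteq> underS \<kappa> c" using small_strict_sup by metis
    then show ?thesis by blast
  qed
  then obtain c where c: "\<And>b. b \<in> Field \<kappa> \<Longrightarrow> b \<sqsubset> c b \<and> (\<forall>\<beta>\<in>underS \<kappa> b. R \<beta> \<subseteq> underS \<kappa> (c b))"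
    by metis
  define e where "e n = (c ^^ n) \<beta>\<^sub>0" for n
  have eF: "e n \<in> Field \<kappa>" for n
  proof (induction n)
    case (Suc n)
    then show ?case using prec_Field[OF conjunct1[OF c]] by (simp add: e_def)
  qed (simp add: e_def b0)
  have e: "e n \<sqsubset> e (Suc n)" "\<beta> \<sqsubset> e n \<Longrightarrow> R \<beta> \<subseteq> underS \<kappa> (e (Suc n))" for n \<beta>
    using c[OF eF[of n]] by (auto simp: e_def)
  obtain \<alpha> where a: "ladder e \<alpha>" using increasing_ladder[of e] e(1) by auto
  have "e 0 \<sqsubset> \<alpha>" by (rule ladderD[OF a])
  moreover have "closure_point R \<alpha>"
    unfolding closure_point_def
  proof
    fix \<beta> assume "\<beta> \<sqsubset> \<alpha>"
    then obtain n where "\<beta> \<sqsubset> e n" using ladderD(3)[OF a] by auto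
    then have "R \<beta> \<subseteq> underS \<kappa> (e (Suc n))" by (rule e(2))
    then show "R \<beta> \<subseteq> underS \<kappa> \<alpha>"
      using prec_trans[OF _ ladderD(2)[OF a]] by auto
  qed
  moreover have "\<alpha> \<in> cof_omega" using a by (auto simp: cof_omega_def)
  ultimately show ?thesis by (auto simp: e_def)
qed

text \<open>For every \<open>n\<close>, pressing down on the \<open>n\<close>-th ladder entry makes one of its fibres stationary.
  If the complement of that fibre were never stationary, then two distinct points would share their
  entire ladder.\<close>

lemma stationary_split:
  "\<exists>S. S \<subseteq> cof_omega \<and> stationary S \<and> stationary (cof_omega - S)"
proof -
  have "\<forall>\<alpha>. \<exists>l. \<alpha> \<in> cof_omega \<longrightarrow> ladder l \<alpha>" by (simp add: cof_omega_def)
  then obtain e where e: "\<And>\<alpha>. \<alpha> \<in> cof_omega \<Longrightarrow> ladder (e \<alpha>) \<alpha>" by metis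
  define D where "D n \<gamma> = {\<alpha> \<in> cof_omega. e \<alpha> n = \<gamma>}" for n \<gamma>
  have press: "\<exists>\<gamma>. stationary (D n \<gamma>)" for n
  proof (rule ccontr)
    assume "\<nexists>\<gamma>. stationary (D n \<gamma>)"
    then have "\<forall>\<gamma>. \<exists>R. small_family R \<and> (\<forall>\<alpha>\<in>D n \<gamma>. \<not> closure_point R \<alpha>)"
      by (simp add: stationary_def)
    then obtain R where R: "\<And>\<gamma>. small_family (R \<gamma>)"
      "\<And>\<gamma> \<alpha>. \<alpha> \<in> D n \<gamma> \<Longrightarrow> \<not> closure_point (R \<gamma>) \<alpha>"
      by metis
    \<comment> \<open>Diagonal intersection: \<open>Q\<close> bundles parameter and argument, so a
      limit point closed under \<open>Q\<close> is closed under \<open>R \<gamma>\<close> for every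
      \<gamma> below it, in particular for its own ladder entry.\<close>
    define Q where "Q \<beta> = (\<Union>\<gamma>\<in>underS \<kappa> \<beta>. \<Union>\<beta>'\<in>underS \<kappa> \<beta>. R \<gamma> \<beta>')" for \<beta>
    have "small_family Q"
      unfolding small_family_def Q_def
    proof (intro ballI conjI)
      fix \<beta> assume "\<beta> \<in> Field \<kappa>"
      then show "small (\<Union>\<gamma>\<in>underS \<kappa> \<beta>. \<Union>\<beta>'\<in>underS \<kappa> \<beta>. R \<gamma> \<beta>')"
        using R(1) prec_Field unfolding small_family_def by (intro small_UN small_underS) blast+
    qed (use R(1) prec_Field in \<open>unfold small_family_def, blast\<close>)
    then obtain \<alpha> where a: "\<alpha> \<in> cof_omega" "closure_point Q \<alpha>"
      using Field_nonempty closure_points_unbounded by (metis ex_in_conv)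
    have n: "e \<alpha> n \<sqsubset> \<alpha>" using ladderD(2)[OF e[OF a(1)]] by simp
    have "closure_point (R (e \<alpha> n)) \<alpha>"
      unfolding closure_point_def
    proof
      fix \<beta> assume "\<beta> \<sqsubset> \<alpha>"
      \<comment> \<open>Since \<alpha> is a limit, argument and parameter lie below a common
        \<open>\<beta>'\<close>, and \<open>R (e \<alpha> n) \<beta>\<close> is part of
        \<open>Q \<beta>'\<close>.\<close>
      then obtain \<beta>' where "\<beta>' \<sqsubset> \<alpha>" "{\<beta>, e \<alpha> n} \<subseteq> underS \<kappa> \<beta>'"
        using ladder_finite_bound[OF e[OF a(1)], of "{\<beta>, e \<alpha> n}"] n by auto
      then show "R (e \<alpha> n) \<beta> \<subseteq> underS \<kappa> \<alpha>"
        using a(2) unfolding closure_point_def Q_def by blast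
    qed
    then show False using R(2)[of \<alpha> "e \<alpha> n"] a(1) by (simp add: D_def)
  qed
  have "\<exists>n \<gamma>. stationary (D n \<gamma>) \<and> stationary (cof_omega - D n \<gamma>)"
  proof (rule ccontr)
    assume "\<not> ?thesis"
    \<comment> \<open>For each \<open>n\<close> take a stationary fibre; under the assumption its
      complement is not stationary, and its index becomes \<open>c n\<close>.\<close>
    then have "\<forall>n. \<exists>\<gamma>. \<not> stationary (cof_omega - D n \<gamma>)" using press by metis
    then have "\<forall>n. \<exists>\<gamma> R. small_family R \<and> (\<forall>\<alpha>\<in>cof_omega - D n \<gamma>. \<not> closure_point R \<alpha>)"
      by (simp add: stationary_def)
    then obtain c R where R: "\<And>n. small_family (R n)"
      "\<And>n \<alpha>. \<alpha> \<in> cof_omega - D n (c n) \<Longrightarrow> \<not> closure_point (R n) \<alpha>"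
      by metis
    \<comment> \<open>Closure under this countable union is closure under every \<open>R n\<close>,
      so closure points of \<open>Q\<close> lie in \<open>D n (c n)\<close> for all
      \<open>n\<close>.\<close>
    define Q where "Q \<beta> = (\<Union>n. R n \<beta>)" for \<beta>
    have "small_family Q"
      unfolding small_family_def Q_def
    proof (intro ballI conjI)
      fix \<beta> assume "\<beta> \<in> Field \<kappa>"
      then show "small (\<Union>n. R n \<beta>)"
        using R(1) by (intro small_UN) (simp_all add: small_countable small_family_def)
    qed (use R(1) in \<open>unfold small_family_def, blast\<close>)
    note Q = closure_points_unbounded[OF this]
    obtain \<alpha> where a: "\<alpha> \<in> cof_omega" "closure_point Q \<alpha>"
      using Field_nonempty Q by (metis ex_in_conv)
    then have "\<alpha> \<in> Field \<kappa>" using prec_Field[OF ladderD(2)[OF e]] by simp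
    \<comment> \<open>Two closure points of \<open>Q\<close> have the same ladder \<open>c\<close>.
      But the ladder of \<open>\<alpha>'\<close> climbs past \<alpha>, while that of \<alpha> stays
      below \<alpha>.\<close>
    then obtain \<alpha>' where a': "\<alpha>' \<in> cof_omega" "closure_point Q \<alpha>'" "\<alpha> \<sqsubset> \<alpha>'"
      using Q by metis
    have "closure_point (R n) \<alpha>" "closure_point (R n) \<alpha>'" for n
      using a(2) a'(2) unfolding closure_point_def Q_def by blast+
    then have same: "e \<alpha> n = c n" "e \<alpha>' n = c n" for n
      using R(2) a(1) a'(1) unfolding D_def by blast+
    obtain n where "\<alpha> \<sqsubset> e \<alpha>' n" using ladderD(3)[OF e[OF a'(1)] a'(3)] by auto
    moreover have "e \<alpha> n \<sqsubset> \<alpha>" using ladderD(2)[OF e[OF a(1)]] by simp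
    ultimately show False using same[of n] prec_trans[of \<alpha> "c n" \<alpha>] prec_irrefl[of \<alpha>] by simp
  qed
  then obtain n \<gamma> where "stationary (D n \<gamma>)" "stationary (cof_omega - D n \<gamma>)" by blast
  moreover have "D n \<gamma> \<subseteq> cof_omega" by (auto simp: D_def)
  ultimately show ?thesis by blast
qed

section \<open>Blocks of iterated successors\<close>

lemma prec_funpow_sc: "d \<in> Field \<kappa> \<Longrightarrow> (sc ^^ n) d \<sqsubset> (sc ^^ Suc n) d"
  using prec_sc[OF funpow_sc_Field] by simp

lemma preceq_funpow_sc: "d \<in> Field \<kappa> \<Longrightarrow> d \<sqsubseteq> (sc ^^ n) d"
proof (induction n)
  case (Suc n)
  then show ?case using preceq_trans prec_imp_preceq[OF prec_funpow_sc] by blast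
qed (simp add: preceq_refl)

text \<open>These points, zero included, start the blocks of order type omega that partition
  \<open>Field \<kappa>\<close>.\<close>

definition nonsucc :: "'a \<Rightarrow> bool" where
  "nonsucc d \<longleftrightarrow> d \<in> Field \<kappa> \<and> (\<forall>a\<in>Field \<kappa>. d \<noteq> sc a)"

text \<open>Stripping successors must stop by well-foundedness. Together with
  \<open>block_unique\<close> this is the decomposition of an ordinal into a limit or zero and a
  finite part.\<close>

lemma ex_block: "\<alpha> \<in> Field \<kappa> \<Longrightarrow> \<exists>d n. nonsucc d \<and> \<alpha> = (sc ^^ n) d"
proof (induction \<alpha> rule: wo.well_order_induct)
  case (1 \<alpha>)
  show ?case
  proof (cases "nonsucc \<alpha>")
    case True
    then show ?thesis by (metis funpow_0)
  next
    case False
    then obtain a where a: "a \<in> Field \<kappa>" "\<alpha> = sc a" using 1(2) by (auto simp: nonsucc_def)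
    then have "a \<noteq> \<alpha> \<and> a \<sqsubseteq> \<alpha>" using prec_sc[OF a(1)] by (simp add: underS_def)
    then obtain d n where d: "nonsucc d" "a = (sc ^^ n) d" using 1(1) a(1) by auto
    then have "\<alpha> = (sc ^^ Suc n) d" using a(2) by simp
    then show ?thesis using d(1) by blast
  qed
qed

text \<open>Cancel successors on both sides; neither \<open>d\<close> nor \<open>d'\<close> is a
  successor, so both sides run out at the same time.\<close>

lemma block_unique:
  "nonsucc d \<Longrightarrow> nonsucc d' \<Longrightarrow> (sc ^^ m) d = (sc ^^ n) d' \<Longrightarrow> d = d' \<and> m = n"
proof (induction m arbitrary: n)
  case 0
  then show ?case
    by (cases n) (auto simp: nonsucc_def funpow_sc_Field)
next
  case (Suc m)
  show ?case
  proof (cases n)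
    case 0
    then show ?thesis using Suc.prems by (auto simp: nonsucc_def funpow_sc_Field)
  next
    case (Suc k)
    then have "sc ((sc ^^ m) d) = sc ((sc ^^ k) d')" using Suc.prems(3) by simp
    then have "(sc ^^ m) d = (sc ^^ k) d'"
      using Suc.prems(1,2) funpow_sc_Field sc_inject by (simp add: nonsucc_def)
    then show ?thesis using Suc.IH[of k] Suc.prems Suc by simp
  qed
qed

text \<open>Reduced to a block start. Arbitrary \<open>d\<close> is needed because the stem of a
  tree may end in the middle of a block.\<close>

lemma funpow_sc_inject: "d \<in> Field \<kappa> \<Longrightarrow> (sc ^^ m) d = (sc ^^ n) d \<Longrightarrow> m = n"
proof -
  assume d: "d \<in> Field \<kappa>" and eq: "(sc ^^ m) d = (sc ^^ n) d"
  obtain d' k where k: "nonsucc d'" "d = (sc ^^ k) d'" using ex_block[OF d] by blast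
  have "(sc ^^ (m + k)) d' = (sc ^^ (n + k)) d'" using eq k(2) by (simp add: funpow_add)
  then show "m = n" using block_unique[OF k(1) k(1)] by fastforce
qed

section \<open>Sequences by recursion, restrictions and finite blocks\<close>

text \<open>Well-founded recursion: \<open>F\<close> sees only the part already built, so the
  operator \<open>H\<close> is admissible and \<open>worec\<close> satisfies the fixpoint
  equation.\<close>

lemma recursive_sequence:
  assumes F: "\<And>\<beta> \<tau>. F \<beta> \<tau> \<in> Field \<kappa>"
  shows "\<exists>x\<in>gen_baire \<kappa>. \<forall>\<beta>\<in>Field \<kappa>. x \<beta> = Some (F \<beta> (x |` underS \<kappa> \<beta>))"
proof -
  define H where "H h \<beta> = (if \<beta> \<in> Field \<kappa> then Some (F \<beta> (h |` underS \<kappa> \<beta>)) else None)"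
    for h :: "'a \<rightharpoonup> 'a" and \<beta>
  have "wo.adm_wo H"
    unfolding wo.adm_wo_def
  proof (intro allI impI)
    fix f g :: "'a \<rightharpoonup> 'a" and \<beta>
    assume "\<forall>y\<in>underS \<kappa> \<beta>. f y = g y"
    then have "f |` underS \<kappa> \<beta> = g |` underS \<kappa> \<beta>" by (auto simp: restrict_map_def)
    then show "H f \<beta> = H g \<beta>" by (simp add: H_def)
  qed
  then have rec: "wo.worec H = H (wo.worec H)" by (rule wo.worec_fixpoint)
  have val: "wo.worec H \<beta> = (if \<beta> \<in> Field \<kappa> then Some (F \<beta> (wo.worec H |` underS \<kappa> \<beta>)) else None)"
    for \<beta>
    by (subst rec) (simp add: H_def)
  show ?thesis
  proof (intro bexI ballI)
    have "ran (wo.worec H) \<subseteq> Field \<kappa>"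
    proof
      fix v assume "v \<in> ran (wo.worec H)"
      then obtain \<beta> where "wo.worec H \<beta> = Some v" by (auto simp: ran_def)
      then have "v = F \<beta> (wo.worec H |` underS \<kappa> \<beta>)"
        by (subst (asm) val) (simp split: if_splits)
      then show "v \<in> Field \<kappa>" using F by simp
    qed
    moreover have "dom (wo.worec H) = Field \<kappa>" by (auto simp: dom_def val)
    ultimately show "wo.worec H \<in> gen_baire \<kappa>" by (simp add: gen_baire_def)
    show "wo.worec H \<beta> = Some (F \<beta> (wo.worec H |` underS \<kappa> \<beta>))" if "\<beta> \<in> Field \<kappa>" for \<beta>
      using that by (subst val) simp
  qed
qed

lemma map_le_restrict: "a \<sqsubseteq> b \<Longrightarrow> x |` underS \<kappa> a \<subseteq>\<^sub>m x |` underS \<kappa> b"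
  using underS_mono by (fastforce simp: map_le_def restrict_map_def split: if_splits)

lemma restrict_short:
  assumes x: "x \<in> gen_baire \<kappa>" and b: "\<beta> \<in> Field \<kappa>"
  shows "x |` underS \<kappa> \<beta> \<in> short_seqs \<kappa>" "dom (x |` underS \<kappa> \<beta>) = underS \<kappa> \<beta>"
proof -
  have "underS \<kappa> \<beta> \<subseteq> dom x" using x prec_Field unfolding gen_baire_def by auto
  then show *: "dom (x |` underS \<kappa> \<beta>) = underS \<kappa> \<beta>" by auto
  have "ran (x |` underS \<kappa> \<beta>) \<subseteq> Field \<kappa>"
    using x unfolding gen_baire_def ran_def restrict_map_def by auto
  then show "x |` underS \<kappa> \<beta> \<in> short_seqs \<kappa>" using * b unfolding short_seqs_def by auto
qed

text \<open>Finite blocks are lists in reverse order, so that appending a value is \<open>Cons\<close>.\<close>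

primrec node :: "('a \<rightharpoonup> 'a) \<Rightarrow> 'a \<Rightarrow> 'a list \<Rightarrow> ('a \<rightharpoonup> 'a)" where
  "node \<sigma> d [] = \<sigma>"
| "node \<sigma> d (\<eta> # s) = (node \<sigma> d s)((sc ^^ length s) d \<mapsto> \<eta>)"

primrec initial :: "(nat \<Rightarrow> 'b) \<Rightarrow> nat \<Rightarrow> 'b list" where
  "initial y 0 = []"
| "initial y (Suc n) = y n # initial y n"

lemma length_initial [simp]: "length (initial y n) = n"
  by (induction n) auto

lemma dom_node:
  assumes "d \<in> Field \<kappa>" "dom \<sigma> = underS \<kappa> d"
  shows "dom (node \<sigma> d s) = underS \<kappa> ((sc ^^ length s) d)"
proof (induction s)
  case (Cons \<eta> s)
  have "underS \<kappa> ((sc ^^ Suc (length s)) d)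
      = insert ((sc ^^ length s) d) (underS \<kappa> ((sc ^^ length s) d))"
    using prec_sc_iff[OF funpow_sc_Field[OF assms(1)]] by auto
  moreover have "dom (node \<sigma> d (\<eta> # s)) = insert ((sc ^^ length s) d) (dom (node \<sigma> d s))"
    by auto
  ultimately show ?case by (metis Cons.IH length_Cons)
qed (simp add: assms)

lemma node_short:
  assumes "d \<in> Field \<kappa>" "dom \<sigma> = underS \<kappa> d" "ran \<sigma> \<subseteq> Field \<kappa>" "set s \<subseteq> Field \<kappa>"
  shows "node \<sigma> d s \<in> short_seqs \<kappa>"
proof -
  have "ran (node \<sigma> d s) \<subseteq> Field \<kappa>"
    using assms(4)
  proof (induction s)
    case (Cons \<eta> s)
    then show ?case by (auto simp: ran_def split: if_splits)
  qed (use assms(3) in simp)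
  then show ?thesis
    using dom_node[OF assms(1,2)] funpow_sc_Field[OF assms(1)] unfolding short_seqs_def by blast
qed

lemma map_le_node:
  assumes "d \<in> Field \<kappa>" "dom \<sigma> = underS \<kappa> d"
  shows "\<sigma> \<subseteq>\<^sub>m node \<sigma> d s"
proof (induction s)
  case (Cons \<eta> s)
  have "(sc ^^ length s) d \<notin> dom \<sigma>"
    using preceq_funpow_sc[OF assms(1)] assms(2) prec_not_preceq by blast
  then show ?case using Cons by (auto simp: map_le_def)
qed simp

text \<open>Ties the lists to the finished sequence: the nodes met while a block is being chosen are
  exactly the restrictions of \<open>x\<close> along that block.\<close>

lemma node_initial:
  assumes d: "d \<in> Field \<kappa>" and x: "\<And>n. x ((sc ^^ n) d) = Some (y n)"
  shows "node (x |` underS \<kappa> d) d (initial y n) = x |` underS \<kappa> ((sc ^^ n) d)"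
proof (induction n)
  case (Suc n)
  have "underS \<kappa> ((sc ^^ Suc n) d) = insert ((sc ^^ n) d) (underS \<kappa> ((sc ^^ n) d))"
    using prec_sc_iff[OF funpow_sc_Field[OF d]] by auto
  then show ?case using Suc x by (simp add: restrict_map_insert)
qed simp

text \<open>Dependent choice on histories: \<open>Q\<close> is the invariant of the finite block
  built so far, and \<open>R\<close> is the demand on its next value.\<close>

lemma greedy_choice:
  assumes "Q []" and step: "\<And>s. Q s \<Longrightarrow> \<exists>\<eta>. Q (\<eta> # s) \<and> R s \<eta>"
  shows "\<exists>y. \<forall>n. Q (initial y n) \<and> R (initial y n) (y n)"
proof -
  obtain c where c: "\<And>s. Q s \<Longrightarrow> Q (c s # s) \<and> R s (c s)" using step by metis
  define L where "L n = ((\<lambda>s. c s # s) ^^ n) []" for n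
  have L: "Q (L n)" for n
    by (induction n) (auto simp: L_def assms(1) c)
  have "initial (\<lambda>n. c (L n)) n = L n" for n
    by (induction n) (auto simp: L_def)
  then show ?thesis using L c by (intro exI[of _ "\<lambda>n. c (L n)"]) simp
qed

section \<open>Suprema of blocks and the closed set\<close>

text \<open>Equivalently, \<alpha> is the least strict upper bound of the values. Monotonicity of
  \<open>y\<close> is not demanded, as the branch through a Laver tree constructed below need not
  increase.\<close>

definition cofinal_in :: "(nat \<Rightarrow> 'a) \<Rightarrow> 'a \<Rightarrow> bool" where
  "cofinal_in y \<alpha> \<longleftrightarrow> (\<forall>n. y n \<sqsubset> \<alpha>) \<and> (\<forall>\<beta>. \<beta> \<sqsubset> \<alpha> \<longrightarrow> (\<exists>n. \<beta> \<sqsubseteq> y n))"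

lemma cofinal_in_le:
  assumes "cofinal_in y \<alpha>" "cofinal_in y \<alpha>'" shows "\<not> \<alpha> \<sqsubset> \<alpha>'"
proof
  assume "\<alpha> \<sqsubset> \<alpha>'"
  then obtain n where "\<alpha> \<sqsubseteq> y n" using assms(2) by (auto simp: cofinal_in_def)
  moreover have "y n \<sqsubset> \<alpha>" using assms(1) by (simp add: cofinal_in_def)
  ultimately show False using prec_not_preceq by simp
qed

text \<open>Serves to refute membership: a block cofinal in a point outside \<open>S\<close> cannot
  also be cofinal in a point of \<open>S\<close>.\<close>

lemma cofinal_in_unique:
  assumes "cofinal_in y \<alpha>" "cofinal_in y \<alpha>'" shows "\<alpha> = \<alpha>'"
proof -
  have "\<alpha> \<in> Field \<kappa>" "\<alpha>' \<in> Field \<kappa>"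
    using assms prec_Field[of "y 0"] by (simp_all add: cofinal_in_def)
  then show ?thesis
    using not_prec cofinal_in_le assms preceq_antisym by simp
qed

text \<open>An increasing sequence and its tails have the same supremum. This transfers a property
  of a full block to blocks that start inside it.\<close>

lemma cofinal_in_shift:
  assumes "cofinal_in y \<alpha>" "\<And>n. y n \<sqsubset> y (Suc n)"
  shows "cofinal_in (\<lambda>n. y (n + k)) \<alpha>"
proof -
  have "y n \<sqsubseteq> y (n + k)" for n
  proof (induction k)
    case 0
    then show ?case using prec_Field[OF assms(2)] preceq_refl by simp
  next
    case (Suc k)
    then show ?case using preceq_trans prec_imp_preceq[OF assms(2)] by simp
  qed
  then show ?thesis using assms(1) preceq_trans unfolding cofinal_in_def by meson
qed

text \<open>The closed set of the theorem, for a suitable \<open>S\<close>. Every point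
  \<open>d\<close> starts a block here, not only limits, since a stem may have any length.\<close>

definition block_sups_in :: "'a set \<Rightarrow> ('a \<rightharpoonup> 'a) set" where
  "block_sups_in S = {x \<in> gen_baire \<kappa>. \<forall>d\<in>Field \<kappa>. \<exists>\<alpha>\<in>S. cofinal_in (\<lambda>n. the (x ((sc ^^ n) d))) \<alpha>}"

lemma in_cone:
  assumes "x \<in> gen_baire \<kappa>" shows "x \<in> cone \<kappa> (x |` underS \<kappa> \<beta>)"
  using assms by (auto simp: cone_def map_le_def)

lemma openin_cone: "\<sigma> \<in> short_seqs \<kappa> \<Longrightarrow> openin (bounded_topology \<kappa>) (cone \<kappa> \<sigma>)"
  unfolding bounded_topology_def by (rule topology_generated_by_Basis) simp

lemma topspace_bounded_topology: "topspace (bounded_topology \<kappa>) = gen_baire \<kappa>"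
proof -
  obtain \<beta> where "\<beta> \<in> Field \<kappa>" using Field_nonempty by auto
  then have "x \<in> \<Union> (cone \<kappa> ` short_seqs \<kappa>)" if "x \<in> gen_baire \<kappa>" for x
    using in_cone[OF that] restrict_short(1)[OF that] by blast
  then show ?thesis
    unfolding bounded_topology_def topology_generated_by_topspace by (auto simp: cone_def)
qed

lemma closedin_block_sups_in: "closedin (bounded_topology \<kappa>) (block_sups_in S)"
  unfolding closedin_def topspace_bounded_topology
proof
  show "block_sups_in S \<subseteq> gen_baire \<kappa>" by (auto simp: block_sups_in_def)
  show "openin (bounded_topology \<kappa>) (gen_baire \<kappa> - block_sups_in S)"
  proof (subst openin_subopen, intro ballI)
    fix x assume x: "x \<in> gen_baire \<kappa> - block_sups_in S"
    then obtain d where d: "d \<in> Field \<kappa>"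
      "\<not> (\<exists>\<alpha>\<in>S. cofinal_in (\<lambda>n. the (x ((sc ^^ n) d))) \<alpha>)"
      by (auto simp: block_sups_in_def)
    \<comment> \<open>\<gamma> is \<open>d + \<omega>\<close>, which is below \<kappa> by
      uncountability; the cone at the restriction to \<gamma> fixes every value on the violating
      block.\<close>
    obtain \<gamma> where g: "ladder (\<lambda>n. (sc ^^ n) d) \<gamma>"
      using increasing_ladder[of "\<lambda>n. (sc ^^ n) d"] prec_funpow_sc[OF d(1)] by auto
    have gF: "\<gamma> \<in> Field \<kappa>" using prec_Field[OF ladderD(2)[OF g]] by simp
    let ?U = "cone \<kappa> (x |` underS \<kappa> \<gamma>)"
    have "z \<notin> block_sups_in S" if "z \<in> ?U" for z
    proof -
      have "z ((sc ^^ n) d) = x ((sc ^^ n) d)" for n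
      proof -
        have n: "(sc ^^ n) d \<sqsubset> \<gamma>" by (rule ladderD(2)[OF g])
        then have "(sc ^^ n) d \<in> dom (x |` underS \<kappa> \<gamma>)"
          using restrict_short(2)[OF _ gF] x by simp
        then have "(x |` underS \<kappa> \<gamma>) ((sc ^^ n) d) = z ((sc ^^ n) d)"
          using that unfolding cone_def map_le_def by blast
        then show ?thesis using n by simp
      qed
      then have "(\<lambda>n. the (z ((sc ^^ n) d))) = (\<lambda>n. the (x ((sc ^^ n) d)))" by simp
      then show ?thesis using d unfolding block_sups_in_def mem_Collect_eq by metis
    qed
    moreover have "openin (bounded_topology \<kappa>) ?U"
      using x restrict_short(1)[OF _ gF] openin_cone by simp
    moreover have "x \<in> ?U" using x in_cone by simp
    moreover have "?U \<subseteq> gen_baire \<kappa>" by (auto simp: cone_def)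
    ultimately show "\<exists>T. openin (bounded_topology \<kappa>) T \<and> x \<in> T \<and> T \<subseteq> gen_baire \<kappa> - block_sups_in S"
      by blast
  qed
qed

section \<open>The set is strongly dominating\<close>

text \<open>Stationarity gives a point of \<open>S\<close> closed under \<open>f\<close> on finite
  blocks above \<sigma>. Below it, each value is chosen above \<open>f\<close>, above the earlier
  values and above the next ladder entry, which yields domination, increase and cofinality.\<close>

lemma dominating_block:
  assumes S: "S \<subseteq> cof_omega" "stationary S" and f: "f \<in> short_seqs \<kappa> \<rightarrow> Field \<kappa>"
    and d: "d \<in> Field \<kappa>" and \<sigma>: "dom \<sigma> = underS \<kappa> d" "ran \<sigma> \<subseteq> Field \<kappa>"
  shows "\<exists>y. (\<forall>n. y n \<sqsubset> y (Suc n)) \<and> (\<exists>\<alpha>\<in>S. cofinal_in y \<alpha>) \<and>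
    (\<forall>n. f (node \<sigma> d (initial y n)) \<sqsubseteq> y n)"
proof -
  have fF: "f (node \<sigma> d s) \<in> Field \<kappa>" if "set s \<subseteq> Field \<kappa>" for s
    using f node_short[OF d \<sigma> that] by blast
  define R where "R \<beta> = (\<lambda>s. f (node \<sigma> d s)) ` lists (underS \<kappa> \<beta>)" for \<beta>
  have "small_family R"
    unfolding small_family_def
  proof (intro ballI conjI)
    fix \<beta> assume "\<beta> \<in> Field \<kappa>"
    then show "small (R \<beta>)" unfolding R_def by (intro small_image small_lists small_underS)
    have "set s \<subseteq> Field \<kappa>" if "s \<in> lists (underS \<kappa> \<beta>)" for s
      using that prec_Field by (auto simp: lists_eq_set)
    then show "R \<beta> \<subseteq> Field \<kappa>" using fF unfolding R_def by blast
  qed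
  then obtain \<alpha> where \<alpha>: "\<alpha> \<in> S" "closure_point R \<alpha>" using S(2) unfolding stationary_def by auto
  then obtain e where e: "ladder e \<alpha>" using S(1) by (auto simp: cof_omega_def)
  have "\<exists>y. \<forall>n. set (initial y n) \<subseteq> underS \<kappa> \<alpha> \<and>
      ((\<forall>\<xi>\<in>set (initial y n). \<xi> \<sqsubset> y n) \<and> e (length (initial y n)) \<sqsubset> y n \<and>
       f (node \<sigma> d (initial y n)) \<sqsubset> y n)"
  proof (rule greedy_choice)
    fix s assume s: "set s \<subseteq> underS \<kappa> \<alpha>"
    \<comment> \<open>The finitely many earlier values lie below one \<beta> below \<alpha>, so
      closure of \<alpha> under \<open>R\<close> puts the value of \<open>f\<close> below
      \<alpha>.\<close>
    obtain \<beta> where b: "\<beta> \<sqsubset> \<alpha>" "set s \<subseteq> underS \<kappa> \<beta>"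
      using ladder_finite_bound[OF e _ s] by auto
    then have "f (node \<sigma> d s) \<in> R \<beta>" unfolding R_def by (auto simp: lists_eq_set)
    then have "f (node \<sigma> d s) \<sqsubset> \<alpha>" using \<alpha>(2) b(1) unfolding closure_point_def by blast
    then have "\<exists>\<eta>. \<eta> \<sqsubset> \<alpha> \<and> insert (f (node \<sigma> d s)) (insert (e (length s)) (set s)) \<subseteq> underS \<kappa> \<eta>"
      using ladderD(2)[OF e] s by (intro ladder_finite_bound[OF e]) auto
    then show "\<exists>\<eta>. set (\<eta> # s) \<subseteq> underS \<kappa> \<alpha> \<and>
        ((\<forall>\<xi>\<in>set s. \<xi> \<sqsubset> \<eta>) \<and> e (length s) \<sqsubset> \<eta> \<and> f (node \<sigma> d s) \<sqsubset> \<eta>)"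
      using s by auto
  qed simp
  then obtain y where y: "\<And>n. set (initial y n) \<subseteq> underS \<kappa> \<alpha>"
    "\<And>n \<xi>. \<xi> \<in> set (initial y n) \<Longrightarrow> \<xi> \<sqsubset> y n" "\<And>n. e n \<sqsubset> y n"
    "\<And>n. f (node \<sigma> d (initial y n)) \<sqsubset> y n"
    by (metis length_initial)
  have "y n \<sqsubset> \<alpha>" for n using y(1)[of "Suc n"] by simp
  moreover have "\<exists>n. \<beta> \<sqsubseteq> y n" if \<beta>: "\<beta> \<sqsubset> \<alpha>" for \<beta>
  proof -
    obtain n where "\<beta> \<sqsubset> e n" using ladderD(3)[OF e \<beta>] ..
    from prec_trans[OF this y(3)] show ?thesis using prec_imp_preceq by blast
  qed
  ultimately have "cofinal_in y \<alpha>" by (simp add: cofinal_in_def)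
  \<comment> \<open>\<open>y n\<close> is the head of \<open>initial y (Suc n)\<close>, so being
    above all earlier values gives the increase.\<close>
  then show ?thesis using y(2)[of _ "Suc _"] y(4) prec_imp_preceq \<alpha>(1)
    by (intro exI[of _ y]) auto
qed

lemma strongly_dominating_block_sups_in:
  assumes S: "S \<subseteq> cof_omega" "stationary S"
  shows "strongly_dominating_family \<kappa> (block_sups_in S)"
  unfolding strongly_dominating_family_def
proof
  fix f :: "('a \<rightharpoonup> 'a) \<Rightarrow> 'a" assume f: "f \<in> short_seqs \<kappa> \<rightarrow> Field \<kappa>"
  obtain a\<^sub>0 where a0: "a\<^sub>0 \<in> Field \<kappa>" using Field_nonempty by auto
  \<comment> \<open>The constant \<open>a\<^sub>0\<close> is the default where \<sigma> is no
    sequence of length \<open>d\<close>, so that \<open>Y\<close> always takes values in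
    \<open>Field \<kappa>\<close>, as the recursion requires.\<close>
  have "\<forall>\<sigma> d. \<exists>y. (\<forall>n. y n \<in> Field \<kappa>) \<and>
      (d \<in> Field \<kappa> \<and> dom \<sigma> = underS \<kappa> d \<and> ran \<sigma> \<subseteq> Field \<kappa> \<longrightarrow>
        (\<forall>n. y n \<sqsubset> y (Suc n)) \<and> (\<exists>\<alpha>\<in>S. cofinal_in y \<alpha>) \<and>
        (\<forall>n. f (node \<sigma> d (initial y n)) \<sqsubseteq> y n))"
    (is "\<forall>\<sigma> d. \<exists>y. ?F y \<and> (?A \<sigma> d \<longrightarrow> ?P \<sigma> d y)")
  proof (intro allI)
    fix \<sigma> d
    show "\<exists>y. ?F y \<and> (?A \<sigma> d \<longrightarrow> ?P \<sigma> d y)"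
    proof (cases "?A \<sigma> d")
      case True
      then obtain y where y: "?P \<sigma> d y" using dominating_block[OF S f, of d \<sigma>] by blast
      then have "?F y" using prec_Field by blast
      then show ?thesis using y by blast
    next
      case False
      then show ?thesis using a0 by (intro exI[of _ "\<lambda>_. a\<^sub>0"]) blast
    qed
  qed
  then obtain Y where YF: "\<And>\<sigma> d n. Y \<sigma> d n \<in> Field \<kappa>"
    and Y: "\<And>\<sigma> d. ?A \<sigma> d \<Longrightarrow> ?P \<sigma> d (Y \<sigma> d)"
    by metis
  obtain base idx where base: "\<And>\<alpha>. \<alpha> \<in> Field \<kappa> \<Longrightarrow> nonsucc (base \<alpha>) \<and> \<alpha> = (sc ^^ idx \<alpha>) (base \<alpha>)"
    using ex_block by metis
  \<comment> \<open>The value at \<beta> consults \<open>x\<close> only below the start of its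
    block, so all points of a block read off one and the same omega-sequence
    \<open>Y\<close>.\<close>
  obtain x where xB: "x \<in> gen_baire \<kappa>"
    and x: "\<And>\<beta>. \<beta> \<in> Field \<kappa> \<Longrightarrow>
      x \<beta> = Some (Y ((x |` underS \<kappa> \<beta>) |` underS \<kappa> (base \<beta>)) (base \<beta>) (idx \<beta>))"
    using recursive_sequence[of "\<lambda>\<beta> \<tau>. Y (\<tau> |` underS \<kappa> (base \<beta>)) (base \<beta>) (idx \<beta>)"] YF
    by meson
  have A: "?A (x |` underS \<kappa> d) d" if "d \<in> Field \<kappa>" for d
    using restrict_short[OF xB that] that unfolding short_seqs_def by simp
  have val: "x ((sc ^^ n) d) = Some (Y (x |` underS \<kappa> d) d n)" if d: "nonsucc d" for d n
  proof -
    have dF: "d \<in> Field \<kappa>" using d by (simp add: nonsucc_def)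
    let ?\<beta> = "(sc ^^ n) d"
    have \<beta>: "?\<beta> \<in> Field \<kappa>" by (rule funpow_sc_Field[OF dF])
    have "base ?\<beta> = d \<and> idx ?\<beta> = n"
      using block_unique[OF _ d, of "base ?\<beta>" "idx ?\<beta>" n] base[OF \<beta>] by metis
    moreover have "underS \<kappa> ?\<beta> \<inter> underS \<kappa> d = underS \<kappa> d"
      using underS_mono[OF preceq_funpow_sc[OF dF]] by blast
    ultimately show ?thesis using x[OF \<beta>] by simp
  qed
  have "x \<in> block_sups_in S"
    unfolding block_sups_in_def
  proof (intro CollectI conjI xB ballI)
    \<comment> \<open>A block from an arbitrary \<open>d'\<close> is a tail of the full block
      containing \<open>d'\<close>, hence has the same supremum.\<close>
    fix d' assume "d' \<in> Field \<kappa>"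
    then obtain d k where d: "nonsucc d" "d' = (sc ^^ k) d" using ex_block by blast
    let ?y = "Y (x |` underS \<kappa> d) d"
    have "?P (x |` underS \<kappa> d) d ?y" using Y A d(1) by (simp add: nonsucc_def)
    then obtain \<alpha> where a: "\<alpha> \<in> S" "cofinal_in (\<lambda>n. ?y (n + k)) \<alpha>"
      using cofinal_in_shift by blast
    have "the (x ((sc ^^ n) d')) = ?y (n + k)" for n
      using val[OF d(1), of "n + k"] d(2) by (simp add: funpow_add)
    then show "\<exists>\<alpha>\<in>S. cofinal_in (\<lambda>n. the (x ((sc ^^ n) d'))) \<alpha>" using a by auto
  qed
  moreover have "strongly_dominates \<kappa> x f"
    unfolding strongly_dominates_def
  \<comment> \<open>Domination holds at every point, so any threshold will do.\<close>
  proof (intro bexI[OF _ a0] ballI impI)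
    fix \<alpha> assume "\<alpha> \<in> Field \<kappa>"
    then obtain d n where d: "nonsucc d" "\<alpha> = (sc ^^ n) d" using ex_block by blast
    then have dF: "d \<in> Field \<kappa>" by (simp add: nonsucc_def)
    show "f (x |` underS \<kappa> \<alpha>) \<sqsubseteq> the (x \<alpha>)"
      using Y[OF A[OF dF]] node_initial[of d x "Y (x |` underS \<kappa> d) d" n, OF dF val[OF d(1)]] val[OF d(1), of n] d(2)
      by (metis option.sel)
  qed
  ultimately show "\<exists>x\<in>block_sups_in S. strongly_dominates \<kappa> x f" by blast
qed

section \<open>Every Laver tree has a branch outside the set\<close>

text \<open>If all successor values were at most \<beta>, the successors would be an image of an
  initial segment, hence fewer than \<kappa>.\<close>

lemma laver_successor:
  assumes succs: "|immediate_successors \<kappa> T \<sigma>| =o \<kappa>"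
    and \<sigma>: "dom \<sigma> = underS \<kappa> a" "a \<in> Field \<kappa>" and b: "\<beta> \<in> Field \<kappa>"
  shows "\<exists>\<eta>. \<beta> \<sqsubset> \<eta> \<and> \<sigma>(a \<mapsto> \<eta>) \<in> T"
proof (rule ccontr)
  assume *: "\<not> ?thesis"
  have "immediate_successors \<kappa> T \<sigma> \<subseteq> (\<lambda>\<eta>. \<sigma>(a \<mapsto> \<eta>)) ` underS \<kappa> (sc \<beta>)"
  proof
    fix \<tau> assume "\<tau> \<in> immediate_successors \<kappa> T \<sigma>"
    then obtain \<alpha> \<eta> where t: "\<tau> \<in> T" "\<alpha> \<in> Field \<kappa>" "\<eta> \<in> Field \<kappa>" "dom \<sigma> = underS \<kappa> \<alpha>"
      "\<tau> = \<sigma>(\<alpha> \<mapsto> \<eta>)"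
      unfolding immediate_successors_def by blast
    then have "\<alpha> = a" using underS_inject \<sigma> by metis
    then have "\<not> \<beta> \<sqsubset> \<eta>" using * t by auto
    then have "\<eta> \<sqsubset> sc \<beta>" using not_prec[OF b t(3)] preceq_prec_trans prec_sc[OF b] by blast
    then show "\<tau> \<in> (\<lambda>\<eta>. \<sigma>(a \<mapsto> \<eta>)) ` underS \<kappa> (sc \<beta>)" using t(5) \<open>\<alpha> = a\<close> by blast
  qed
  then have "small (immediate_successors \<kappa> T \<sigma>)"
    by (rule small_subset) (intro small_image small_underS sc_Field b)
  from not_ordLess_ordIso[OF this] show False using succs by simp
qed

text \<open>The branch follows the stem, then omega values cofinal in a point of cofinality omega
  outside \<open>S\<close>, then arbitrary tree successors; limit closure carries it through
  limits.\<close>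

lemma laver_branch_avoiding:
  assumes T: "laver_tree \<kappa> T" and S: "stationary (cof_omega - S)"
  shows "\<exists>x\<in>branches \<kappa> T. x \<notin> block_sups_in S"
proof -
  have tree: "is_tree \<kappa> T" and lim: "limit_closed \<kappa> T" using T by (auto simp: laver_tree_def)
  obtain \<sigma> where \<sigma>: "\<sigma> \<in> T"
    and succs: "\<And>\<tau>. \<tau> \<in> T \<Longrightarrow> \<sigma> \<subseteq>\<^sub>m \<tau> \<Longrightarrow> |immediate_successors \<kappa> T \<tau>| =o \<kappa>"
    using T unfolding laver_tree_def is_stem_def by blast
  have short: "\<sigma> \<in> short_seqs \<kappa>" using \<sigma> tree by (auto simp: is_tree_def)
  then obtain d where d: "d \<in> Field \<kappa>" "dom \<sigma> = underS \<kappa> d" and ran: "ran \<sigma> \<subseteq> Field \<kappa>"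
    by (auto simp: short_seqs_def)
  let ?p = "\<lambda>n. (sc ^^ n) d"
  have "\<forall>s \<beta>. \<exists>\<eta>. node \<sigma> d s \<in> T \<and> \<beta> \<in> Field \<kappa> \<longrightarrow> \<beta> \<sqsubset> \<eta> \<and> node \<sigma> d (\<eta> # s) \<in> T"
  proof (intro allI)
    fix s \<beta>
    show "\<exists>\<eta>. node \<sigma> d s \<in> T \<and> \<beta> \<in> Field \<kappa> \<longrightarrow> \<beta> \<sqsubset> \<eta> \<and> node \<sigma> d (\<eta> # s) \<in> T"
      using laver_successor[OF succs[OF _ map_le_node[OF d]] dom_node[OF d] funpow_sc_Field[OF d(1)]]
      by simp
  qed
  then obtain g where g: "\<And>s \<beta>. node \<sigma> d s \<in> T \<Longrightarrow> \<beta> \<in> Field \<kappa> \<Longrightarrow>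
      \<beta> \<sqsubset> g s \<beta> \<and> node \<sigma> d (g s \<beta> # s) \<in> T"
    by metis
  \<comment> \<open>Collects the chosen successors for all blocks and bounds below \<beta>. The
    intersection with \<open>Field \<kappa>\<close> is needed because \<open>g\<close> is
    unconstrained at nodes outside \<open>T\<close>.\<close>
  define R where "R \<beta> = (\<Union>s\<in>lists (underS \<kappa> \<beta>). g s ` underS \<kappa> \<beta>) \<inter> Field \<kappa>" for \<beta>
  have "small (R \<beta>)" if "\<beta> \<in> Field \<kappa>" for \<beta>
    unfolding R_def
    by (rule small_subset[OF Int_lower1]) (intro small_UN small_lists small_image small_underS that)
  then have "small_family R" by (auto simp: small_family_def R_def)
  then obtain \<alpha> where \<alpha>: "\<alpha> \<in> cof_omega" "\<alpha> \<notin> S" "closure_point R \<alpha>"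
    using S unfolding stationary_def by blast
  then obtain e where e: "ladder e \<alpha>" by (auto simp: cof_omega_def)
  have "\<exists>y. \<forall>n. (set (initial y n) \<subseteq> underS \<kappa> \<alpha> \<and> node \<sigma> d (initial y n) \<in> T) \<and>
      e (length (initial y n)) \<sqsubset> y n"
  proof (rule greedy_choice)
    fix s assume s: "set s \<subseteq> underS \<kappa> \<alpha> \<and> node \<sigma> d s \<in> T"
    \<comment> \<open>The successor is taken above the next ladder entry for cofinality; closure of
      \<alpha> under \<open>R\<close> keeps it below \<alpha>.\<close>
    let ?\<eta> = "g s (e (length s))"
    have \<eta>: "e (length s) \<sqsubset> ?\<eta>" "node \<sigma> d (?\<eta> # s) \<in> T"
      using g s prec_Field[OF ladderD(2)[OF e]] by blast+
    obtain \<beta> where b: "\<beta> \<sqsubset> \<alpha>" "insert (e (length s)) (set s) \<subseteq> underS \<kappa> \<beta>"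
      using ladder_finite_bound[OF e, of "insert (e (length s)) (set s)"] s ladderD(2)[OF e] by auto
    then have "?\<eta> \<in> R \<beta>" using prec_Field[OF \<eta>(1)] unfolding R_def by (auto simp: lists_eq_set)
    then have "?\<eta> \<sqsubset> \<alpha>" using \<alpha>(3) b(1) unfolding closure_point_def by blast
    then show "\<exists>\<eta>. (set (\<eta> # s) \<subseteq> underS \<kappa> \<alpha> \<and> node \<sigma> d (\<eta> # s) \<in> T) \<and> e (length s) \<sqsubset> \<eta>"
      using \<eta> s by (intro exI[of _ ?\<eta>]) simp
  qed (simp add: \<sigma>)
  then obtain y where y: "\<And>n. set (initial y n) \<subseteq> underS \<kappa> \<alpha>"
    "\<And>n. node \<sigma> d (initial y n) \<in> T" "\<And>n. e n \<sqsubset> y n"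
    by (metis length_initial)
  have y\<alpha>: "y n \<sqsubset> \<alpha>" for n using y(1)[of "Suc n"] by simp
  have "\<exists>n. \<beta> \<sqsubseteq> y n" if \<beta>: "\<beta> \<sqsubset> \<alpha>" for \<beta>
  proof -
    obtain n where "\<beta> \<sqsubset> e n" using ladderD(3)[OF e \<beta>] ..
    from prec_trans[OF this y(3)] show ?thesis using prec_imp_preceq by blast
  qed
  then have cof: "cofinal_in y \<alpha>" using y\<alpha> by (simp add: cofinal_in_def)
  obtain a\<^sub>0 where a0: "a\<^sub>0 \<in> Field \<kappa>" using Field_nonempty by auto
  \<comment> \<open>\<open>E\<close> picks a value that stays in the tree whenever there is one, and
    otherwise some default in \<open>Field \<kappa>\<close>.\<close>
  have "\<forall>\<beta> \<tau>. \<exists>\<eta>. \<eta> \<in> Field \<kappa> \<and> ((\<exists>\<eta>\<in>Field \<kappa>. \<tau>(\<beta> \<mapsto> \<eta>) \<in> T) \<longrightarrow> \<tau>(\<beta> \<mapsto> \<eta>) \<in> T)"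
    using a0 by blast
  then obtain E where E: "\<And>\<beta> \<tau>. E \<beta> \<tau> \<in> Field \<kappa>"
    "\<And>\<beta> \<tau> \<eta>. \<eta> \<in> Field \<kappa> \<Longrightarrow> \<tau>(\<beta> \<mapsto> \<eta>) \<in> T \<Longrightarrow> \<tau>(\<beta> \<mapsto> E \<beta> \<tau>) \<in> T"
    by metis
  \<comment> \<open>Three stages: the stem, the omega values \<open>y\<close> starting at its length
    \<open>d\<close>, and the choice \<open>E\<close> elsewhere. The index under \<open>SOME\<close>
    is unique by \<open>funpow_sc_inject\<close>.\<close>
  define F where "F \<beta> \<tau> = (if \<beta> \<in> dom \<sigma> then the (\<sigma> \<beta>)
    else if \<exists>n. \<beta> = ?p n then y (SOME n. \<beta> = ?p n) else E \<beta> \<tau>)" for \<beta> \<tau>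
  have "F \<beta> \<tau> \<in> Field \<kappa>" for \<beta> \<tau>
    using ran E(1) prec_Field[OF y\<alpha>] unfolding F_def by (auto simp: ran_def)
  then obtain x where xB: "x \<in> gen_baire \<kappa>"
    and x: "\<And>\<beta>. \<beta> \<in> Field \<kappa> \<Longrightarrow> x \<beta> = Some (F \<beta> (x |` underS \<kappa> \<beta>))"
    using recursive_sequence[of F] by meson
  have x\<sigma>: "x |` underS \<kappa> d = \<sigma>"
  proof
    fix \<xi>
    show "(x |` underS \<kappa> d) \<xi> = \<sigma> \<xi>"
    proof (cases "\<xi> \<sqsubset> d")
      case True
      then have "\<xi> \<in> dom \<sigma>" using d(2) by simp
      then show ?thesis using True x prec_Field[OF True] by (auto simp: F_def)
    next
      case False
      then have "\<xi> \<notin> dom \<sigma>" using d(2) by simp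
      then have "\<sigma> \<xi> = None" by auto
      then show ?thesis using False by simp
    qed
  qed
  have xp: "x (?p n) = Some (y n)" for n
  proof -
    have "?p n \<notin> dom \<sigma>" using preceq_funpow_sc[OF d(1)] d(2) prec_not_preceq by blast
    moreover have "(SOME m. ?p n = ?p m) = n"
      using funpow_sc_inject[OF d(1)] by (intro some_equality) auto
    ultimately show ?thesis using x[OF funpow_sc_Field[OF d(1)]] by (auto simp: F_def)
  qed
  have xpT: "x |` underS \<kappa> (?p n) \<in> T" for n
    using y(2)[of n] node_initial[of d x y n, OF d(1) xp] x\<sigma> by simp
  have "\<beta> \<in> Field \<kappa> \<longrightarrow> x |` underS \<kappa> \<beta> \<in> T" for \<beta>
  proof (induction \<beta> rule: wo.well_order_induct, intro impI)
    fix \<beta> assume IH: "\<forall>b. b \<noteq> \<beta> \<and> b \<sqsubseteq> \<beta> \<longrightarrow> b \<in> Field \<kappa> \<longrightarrow> x |` underS \<kappa> b \<in> T"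
      and b: "\<beta> \<in> Field \<kappa>"
    have IH: "x |` underS \<kappa> b \<in> T" if "b \<sqsubset> \<beta>" for b
      using IH that prec_Field[OF that] by (simp add: underS_def)
    \<comment> \<open>Up to the block, nodes are initial segments of nodes already in
      \<open>T\<close>; beyond it, \<beta> is a successor or a limit, zero being excluded by
      \<open>d \<sqsubset> \<beta>\<close>.\<close>
    consider n where "\<beta> \<sqsubseteq> ?p n" | a where "\<And>n. ?p n \<sqsubset> \<beta>" "a \<in> Field \<kappa>" "\<beta> = sc a"
      | "\<And>n. ?p n \<sqsubset> \<beta>" "nonsucc \<beta>"
      using not_prec[OF funpow_sc_Field[OF d(1)] b] b unfolding nonsucc_def by blast
    then show "x |` underS \<kappa> \<beta> \<in> T"
    proof cases
      case 1
      have "x |` underS \<kappa> \<beta> \<subseteq>\<^sub>m x |` underS \<kappa> (?p n)"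
        by (rule map_le_restrict[OF 1])
      then show ?thesis
        using tree xpT restrict_short(1)[OF xB b] unfolding is_tree_def by blast
    next
      case 2
      let ?\<tau> = "x |` underS \<kappa> a"
      have \<tau>: "?\<tau> \<in> T" using IH prec_sc 2 by simp
      \<comment> \<open>Were \<open>a\<close> in the block, its successor \<beta> would be in the
        block too; so the value at \<open>a\<close> comes from \<open>E\<close>.\<close>
      have new: "a \<noteq> ?p n" for n
        using 2(1)[of "Suc n"] 2(3) prec_irrefl by auto
      have "d \<sqsubset> sc a" using 2(1)[of 0] 2(3) by simp
      then have "d = a \<or> d \<sqsubset> a" using prec_sc_iff[OF 2(2)] by simp
      then have da: "d \<sqsubseteq> a" using prec_imp_preceq preceq_refl[OF 2(2)] by auto
      then have "\<sigma> \<subseteq>\<^sub>m ?\<tau>" using map_le_restrict[OF da, of x] x\<sigma> by simp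
      from laver_successor[OF succs[OF \<tau> this] restrict_short(2)[OF xB 2(2)] 2(2) a0]
      obtain \<eta> where \<eta>: "a\<^sub>0 \<sqsubset> \<eta>" "?\<tau>(a \<mapsto> \<eta>) \<in> T" by blast
      have "?\<tau>(a \<mapsto> E a ?\<tau>) \<in> T" using E(2)[OF _ \<eta>(2)] prec_Field[OF \<eta>(1)] by simp
      moreover have "a \<notin> dom \<sigma>" using d(2) da prec_not_preceq by auto
      then have "x a = Some (E a ?\<tau>)" using x[OF 2(2)] new by (simp add: F_def)
      moreover have "underS \<kappa> \<beta> = insert a (underS \<kappa> a)" using prec_sc_iff[OF 2(2)] 2(3) by auto
      ultimately show ?thesis by (simp add: restrict_map_insert)
    next
      case 3
      have sc: "sc b \<sqsubset> \<beta>" if "b \<sqsubset> \<beta>" for b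
        using sc_least[OF that] 3(2) prec_Field[OF that] by (auto simp: underS_def nonsucc_def)
      have "is_limit \<kappa> \<beta>"
        unfolding is_limit_def
      proof (intro conjI ballI b)
        show "underS \<kappa> \<beta> \<noteq> {}" using 3(1) by blast
        fix c assume c: "c \<sqsubset> \<beta>"
        have "c \<sqsubset> sc c" using prec_sc prec_Field[OF c] by simp
        then show "\<exists>\<gamma>\<in>underS \<kappa> \<beta>. c \<sqsubseteq> \<gamma> \<and> c \<noteq> \<gamma>" using sc[OF c] by (auto simp: underS_def)
      qed
      moreover have "\<forall>c\<in>underS \<kappa> \<beta>. x |` underS \<kappa> c \<in> T" using IH by blast
      moreover have "\<forall>c\<in>underS \<kappa> \<beta>. \<forall>c'\<in>underS \<kappa> \<beta>. c \<sqsubseteq> c' \<longrightarrow>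
          x |` underS \<kappa> c \<subseteq>\<^sub>m x |` underS \<kappa> c'"
        by (intro ballI impI map_le_restrict)
      \<comment> \<open>The restriction to the limit \<beta> is the union of the earlier
        restrictions, each \<xi> below \<beta> being covered at \<open>sc \<xi>\<close>; this is the
        form that \<open>limit_closed\<close> expects.\<close>
      moreover have "Map.graph (x |` underS \<kappa> \<beta>) = (\<Union>c\<in>underS \<kappa> \<beta>. Map.graph (x |` underS \<kappa> c))"
      proof (intro set_eqI iffI)
        fix q assume "q \<in> Map.graph (x |` underS \<kappa> \<beta>)"
        then obtain \<xi> v where q: "q = (\<xi>, v)" "\<xi> \<sqsubset> \<beta>" "x \<xi> = Some v"
          by (auto simp: Map.graph_def restrict_map_def split: if_splits)
        have "\<xi> \<sqsubset> sc \<xi>" using prec_sc prec_Field[OF q(2)] by simp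
        then have "q \<in> Map.graph (x |` underS \<kappa> (sc \<xi>))" using q by (auto simp: Map.graph_def)
        then show "q \<in> (\<Union>c\<in>underS \<kappa> \<beta>. Map.graph (x |` underS \<kappa> c))" using sc[OF q(2)] by blast
      next
        fix q assume "q \<in> (\<Union>c\<in>underS \<kappa> \<beta>. Map.graph (x |` underS \<kappa> c))"
        then obtain c \<xi> v where q: "c \<sqsubset> \<beta>" "q = (\<xi>, v)" "\<xi> \<sqsubset> c" "x \<xi> = Some v"
          by (auto simp: Map.graph_def restrict_map_def split: if_splits)
        then show "q \<in> Map.graph (x |` underS \<kappa> \<beta>)"
          using prec_trans[OF q(3,1)] by (auto simp: Map.graph_def)
      qed
      ultimately show ?thesis
        using lim[unfolded limit_closed_def, rule_format, of \<beta> "\<lambda>c. x |` underS \<kappa> c" "x |` underS \<kappa> \<beta>"]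
        by simp
    qed
  qed
  then have "x \<in> branches \<kappa> T" using xB by (simp add: branches_def)
  moreover have "x \<notin> block_sups_in S"
  proof
    assume "x \<in> block_sups_in S"
    \<comment> \<open>Membership is tested on the block starting at the length \<open>d\<close> of
      the stem, where \<open>x\<close> takes the values \<open>y\<close>.\<close>
    then obtain \<alpha>' where "\<alpha>' \<in> S" "cofinal_in y \<alpha>'"
      using d(1) xp unfolding block_sups_in_def by auto
    then show False using cofinal_in_unique[OF cof] \<alpha>(2) by blast
  qed
  ultimately show ?thesis by blast
qed

end

theorem theorem4p5:
  fixes \<kappa> :: "'a rel"
  assumes "Card_order \<kappa>" and "natLeq <o \<kappa>" and "regularCard \<kappa>"
  shows "\<exists>C. closedin (bounded_topology \<kappa>) C \<and> C \<notin> nondominating_ideal \<kappa> \<and>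
           \<not> (\<exists>T. laver_tree \<kappa> T \<and> branches \<kappa> T \<subseteq> C)"
proof -
  interpret uncountable_regular \<kappa> using assms by unfold_locales
  obtain S where S: "S \<subseteq> cof_omega" "stationary S" "stationary (cof_omega - S)"
    using stationary_split by blast
  have "block_sups_in S \<notin> nondominating_ideal \<kappa>"
    using strongly_dominating_block_sups_in[OF S(1,2)] by (simp add: nondominating_ideal_def)
  moreover have "\<not> (\<exists>T. laver_tree \<kappa> T \<and> branches \<kappa> T \<subseteq> block_sups_in S)"
    using laver_branch_avoiding[OF _ S(3)] by blast
  ultimately show ?thesis using closedin_block_sups_in by blast
qed

end
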